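(* Let $T>0$ denote the total number of iterations of the form $x_{t+1}=x_t-\gamma_t g_t$ made by LB-SGD, and let $\hat\delta\in(0,1)$ denote the target confidence level. If LB-SGD is run with confidence parameter $\delta\le \hat\delta/(mT)$, then all the query points $x_t$ are feasible, i.e. $x_t\in\mathcal X$ for all $t\in[T]$, with probability at least $1-\hat\delta$.
   Context: Problem: minimize $f^0(x)$ over $x\in\mathbb R^d$ subject to $f^i(x)\le 0$, $i\in[m]:=\{1,\dots,m\}$, with differentiable $f^i:\mathbb R^d\to\mathbb R$; feasible set $\mathcal X=\{x\in\mathbb R^d: f^i(x)\le 0,\ i\in[m]\}$. $\|\cdot\|$ is the Euclidean norm. A function $f$ is $L$-Lipschitz on $\mathcal X$ if $|f(x)-f(y)|\le L\|x-y\|$ for all $x,y\in\mathcal X$, and $M$-smooth on $\mathcal X$ if $f(x)\le f(y)+\langle\nabla f(y),x-y\rangle+\frac M2\|x-y\|^2$ for all $x,y\in\mathcal X$. Standing assumptions: (1) $\|x-y\|\le R$ for all $x,y\in\mathcal X$. (2) Each $f^i$, $i=0,\dots,m$, is $M_i$-smooth and $L_i$-Lipschitz on $\mathcal X$, with $L_i,M_i>0$; the $M_i$ are known. (3) A point $x_0\in\mathcal X$ with $\max_{i\in[m]}f^i(x_0)\le-\beta$, $\beta>0$, is known. (4) (Extended MFCQ) For some $\rho\in(0,\beta/2]$ and some $l>0$: for every $x\in\mathcal X$ there is $s_x\in\mathbb R^d$, $\|s_x\|=1$, with $\langle s_x,\nabla f^i(x)\rangle>l$ for all $i\in\mathcal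 I_\rho(x):=\{i\in[m]:-f^i(x)\le\rho\}$. Oracle: a query at $x$ returns random $F^i(x,\xi)\in\mathbb R$ and $G^i(x,\xi)\in\mathbb R^d$, $i=0,\dots,m$. $F^i$ is unbiased, $\mathbb E F^i(x,\xi)=f^i(x)$, and sub-Gaussian with parameter $\sigma_i$; $G^i$ has bias $\|\mathbb E G^i(x,\xi)-\nabla f^i(x)\|\le\hat b_i$ and is sub-Gaussian with $\mathbb E\|G^i-\mathbb EG^i\|^2\le\hat\sigma_i^2$. $F^i_n(x,\xi),G^i_n(x,\xi)$ denote averages of $n$ independent oracle outputs at $x$, and $\sigma_i(n)=\sigma_i/\sqrt n$, $\hat\sigma_i(n)=\hat\sigma_i/\sqrt n$. The sub-Gaussian property means that for each fixed $x$ and every $\delta\in(0,1)$: $\mathbb P\{|F^i_n(x,\xi)-f^i(x)|\le\sigma_i(n)\sqrt{\ln(1/\delta)}\}\ge1-\delta$ and $\mathbb P\{\|G^i_n(x,\xi)-\nabla f^i(x)\|\le\hat b_i+\hat\sigma_i(n)\sqrt{\ln(1/\delta)}\}\ge1-\delta$. LB-SGD (with barrier parameter $\eta>0$, number of iterations $T$, batch size $n$, confidence parameter $\delta$): starting from $x_1:=x_0$, for $t=1,\dots,T$ take a fresh batch of $n$ oracle samples at $x_t$ and set $\bar\alpha_t^i=-F^i_n(x_t,\xi_t)$, $g_t=G^0_n(x_t,\xi_t)+\eta\sum_{i=1}^m G^i_n(x_t,\xi_t)/\bar\alpha_t^i$, $\underline\alpha_t^i=\bar\alpha_t^i-\sigma_i(n)\sqrt{\ln(1/\delta)}$,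 $\hat\theta_t^i=|\langle G^i_n(x_t,\xi_t),g_t/\|g_t\|\rangle|+\hat b_i+\hat\sigma_i(n)\sqrt{\ln(1/\delta)}$, $\hat M_2(x_t)=M_0+10\eta\sum_{i=1}^m\frac{M_i}{\underline\alpha_t^i}+8\eta\sum_{i=1}^m\frac{(\hat\theta_t^i)^2}{(\underline\alpha_t^i)^2}$, $\gamma_t=\min\Big\{\min_{i\in[m]}\Big\{\frac{\underline\alpha_t^i}{2|\hat\theta_t^i|+\sqrt{\underline\alpha_t^iM_i}}\Big\}\frac1{\|g_t\|},\ \frac1{\hat M_2(x_t)}\Big\}$, and $x_{t+1}=x_t-\gamma_tg_t$. (If some $\underline\alpha_t^i\le0$ there is no safe nonzero step and $\gamma_t=0$.) *)

theory Defs
  imports "HOL-Probability.Probability"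
begin

definition grad :: "(real ^ 'd \<Rightarrow> real) \<Rightarrow> real ^ 'd \<Rightarrow> real ^ 'd" where
  "grad f x = (THE D. GDERIV f x :> D)"

lemma GDERIV_grad:
  fixes f :: "real ^ 'd \<Rightarrow> real"
  assumes "f differentiable (at x)"
  shows "GDERIV f x :> grad f x"
proof -
  let ?D = "frechet_derivative f (at x)"
  have D: "(f has_derivative ?D) (at x)"
    using assms frechet_derivative_works by blast
  have lin: "linear ?D"
    using D by (rule has_derivative_linear)
  have "?D = (\<lambda>h. h \<bullet> (\<Sum>b\<in>Basis. ?D b *\<^sub>R b))"
  proof
    fix h :: "real ^ 'd"
    have "?D h = ?D (\<Sum>b\<in>Basis. (h \<bullet> b) *\<^sub>R b)"
      by (simp add: euclidean_representation)
    also have "\<dots> = (\<Sum>b\<in>Basis. (h \<bullet> b) * ?D b)"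
      by (simp add: linear_sum[OF lin] linear_scale[OF lin])
    also have "\<dots> = h \<bullet> (\<Sum>b\<in>Basis. ?D b *\<^sub>R b)"
      by (simp add: inner_sum_right mult.commute)
    finally show "?D h = h \<bullet> (\<Sum>b\<in>Basis. ?D b *\<^sub>R b)" .
  qed
  with D have ex: "GDERIV f x :> (\<Sum>b\<in>Basis. ?D b *\<^sub>R b)"
    by (simp add: gderiv_def)
  have uniq: "E = E'" if "GDERIV f x :> E" "GDERIV f x :> E'" for E E'
  proof -
    have "(\<lambda>h. h \<bullet> E) = (\<lambda>h. h \<bullet> E')"
      using that has_derivative_unique unfolding gderiv_def by blast
    then show ?thesis
      by (metis inner_commute vector_eq_rdot)
  qed
  show ?thesis
    unfolding grad_def using ex uniq by (metis theI)
qed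

definition feasible_set :: "nat \<Rightarrow> (nat \<Rightarrow> real ^ 'd \<Rightarrow> real) \<Rightarrow> (real ^ 'd) set" where
  "feasible_set m f = {x. \<forall>i\<in>{1..m}. f i x \<le> 0}"

definition smooth_fun_on :: "real \<Rightarrow> (real ^ 'd) set \<Rightarrow> (real ^ 'd \<Rightarrow> real) \<Rightarrow> bool" where
  "smooth_fun_on M X f \<longleftrightarrow>
     (\<forall>x\<in>X. \<forall>y\<in>X. f x \<le> f y + grad f y \<bullet> (x - y) + M / 2 * (norm (x - y))\<^sup>2)"

definition ext_mfcq ::
  "nat \<Rightarrow> (nat \<Rightarrow> real ^ 'd \<Rightarrow> real) \<Rightarrow> real \<Rightarrow> real \<Rightarrow> bool" where
  "ext_mfcq m f \<rho> l \<longleftrightarrow>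
     (\<forall>x\<in>feasible_set m f. \<exists>s. norm s = 1 \<and>
        (\<forall>i\<in>{i\<in>{1..m}. - f i x \<le> \<rho>}. s \<bullet> grad (f i) x > l))"

definition batch_mean :: "nat \<Rightarrow> ('z \<Rightarrow> 'b::real_vector) \<Rightarrow> (nat \<Rightarrow> 'z) \<Rightarrow> 'b" where
  "batch_mean n h \<omega> = (\<Sum>k<n. h (\<omega> k)) /\<^sub>R real n"

(* Sub-Gaussian deviation, up to bias b, of averages of independent copies of h from c. *)
definition sub_gaussian_means ::
  "'z measure \<Rightarrow> ('z \<Rightarrow> 'b::real_normed_vector) \<Rightarrow> 'b \<Rightarrow> real \<Rightarrow> real \<Rightarrow> bool" where
  "sub_gaussian_means D h c b \<sigma> \<longleftrightarrow>
     (\<forall>n\<ge>1. \<forall>\<delta>\<in>{0<..<1}.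
        \<P>(\<omega> in (\<Pi>\<^sub>M k\<in>{..<n}. D).
             norm (batch_mean n h \<omega> - c) \<le> b + \<sigma> / sqrt (real n) * sqrt (ln (1 / \<delta>)))
          \<ge> 1 - \<delta>)"

(* A query at x with noise z ~ D returns all F i x z and G i x z (i = 0..m); these share z, so
   no independence between the components is imposed. Joint measurability in (x, z) is what
   makes the outputs at the random query points random variables. *)
definition value_oracle ::
  "'z measure \<Rightarrow> (real ^ 'd \<Rightarrow> real) \<Rightarrow> real \<Rightarrow> (real ^ 'd \<Rightarrow> 'z \<Rightarrow> real) \<Rightarrow> bool" where
  "value_oracle D f \<sigma> F \<longleftrightarrow>
     case_prod F \<in> borel_measurable (borel \<Otimes>\<^sub>M D) \<and>
     (\<forall>x. integrable D (F x) \<and> (\<integral>z. F x z \<partial>D) = f x \<and>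
          sub_gaussian_means D (F x) (f x) 0 \<sigma>)"

definition gradient_oracle ::
  "'z measure \<Rightarrow> (real ^ 'd \<Rightarrow> real) \<Rightarrow> real \<Rightarrow> real \<Rightarrow> (real ^ 'd \<Rightarrow> 'z \<Rightarrow> real ^ 'd) \<Rightarrow> bool"
  where
  "gradient_oracle D f b \<sigma> G \<longleftrightarrow>
     case_prod G \<in> borel_measurable (borel \<Otimes>\<^sub>M D) \<and>
     (\<forall>x. integrable D (G x) \<and>
          norm ((\<integral>z. G x z \<partial>D) - grad f x) \<le> b \<and>
          integrable D (\<lambda>z. (norm (G x z - (\<integral>z'. G x z' \<partial>D)))\<^sup>2) \<and>
          (\<integral>z. (norm (G x z - (\<integral>z'. G x z' \<partial>D)))\<^sup>2 \<partial>D) \<le> \<sigma>\<^sup>2 \<and>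
          sub_gaussian_means D (G x) (grad f x) b \<sigma>)"

(* One step from x, given the batch means Fn i and Gn i observed at x. If g = 0 the quotients
   by norm g are 0 by the convention a / 0 = 0, and the step leaves x unchanged in any case. *)
definition lb_sgd_step ::
  "nat \<Rightarrow> (nat \<Rightarrow> real) \<Rightarrow> (nat \<Rightarrow> real) \<Rightarrow> (nat \<Rightarrow> real) \<Rightarrow> (nat \<Rightarrow> real) \<Rightarrow>
   real \<Rightarrow> nat \<Rightarrow> real \<Rightarrow> (nat \<Rightarrow> real) \<Rightarrow> (nat \<Rightarrow> real ^ 'd) \<Rightarrow> real ^ 'd \<Rightarrow> real ^ 'd" where
  "lb_sgd_step m M \<sigma> b \<sigma>' \<eta> n \<delta> Fn Gn x =
     (let \<alpha> = (\<lambda>i. - Fn i);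
          g = Gn 0 + \<eta> *\<^sub>R (\<Sum>i=1..m. Gn i /\<^sub>R \<alpha> i);
          \<alpha>l = (\<lambda>i. \<alpha> i - \<sigma> i / sqrt (real n) * sqrt (ln (1 / \<delta>)));
          \<theta> = (\<lambda>i. \<bar>Gn i \<bullet> (g /\<^sub>R norm g)\<bar> + b i + \<sigma>' i / sqrt (real n) * sqrt (ln (1 / \<delta>)));
          M2 = M 0 + 10 * \<eta> * (\<Sum>i=1..m. M i / \<alpha>l i)
                   + 8 * \<eta> * (\<Sum>i=1..m. (\<theta> i)\<^sup>2 / (\<alpha>l i)\<^sup>2);
          \<gamma> = (if \<exists>i\<in>{1..m}. \<alpha>l i \<le> 0 then 0
               else min ((MIN i\<in>{1..m}. \<alpha>l i / (2 * \<bar>\<theta> i\<bar> + sqrt (\<alpha>l i * M i))) * (1 / norm g))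
                        (1 / M2))
      in x - \<gamma> *\<^sub>R g)"

(* The t-th query point, as a function of the noise z t k of the k-th sample in iteration t;
   both index 0 and index 1 give the initial point. *)
primrec lb_sgd ::
  "nat \<Rightarrow> (nat \<Rightarrow> real) \<Rightarrow> (nat \<Rightarrow> real) \<Rightarrow> (nat \<Rightarrow> real) \<Rightarrow> (nat \<Rightarrow> real) \<Rightarrow>
   real \<Rightarrow> nat \<Rightarrow> real \<Rightarrow> (nat \<Rightarrow> real ^ 'd \<Rightarrow> 'z \<Rightarrow> real) \<Rightarrow> (nat \<Rightarrow> real ^ 'd \<Rightarrow> 'z \<Rightarrow> real ^ 'd) \<Rightarrow>
   real ^ 'd \<Rightarrow> (nat \<Rightarrow> nat \<Rightarrow> 'z) \<Rightarrow> nat \<Rightarrow> real ^ 'd" where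
  "lb_sgd m M \<sigma> b \<sigma>' \<eta> n \<delta> F G x0 z 0 = x0"
| "lb_sgd m M \<sigma> b \<sigma>' \<eta> n \<delta> F G x0 z (Suc t) =
     (if t = 0 then x0
      else let x = lb_sgd m M \<sigma> b \<sigma>' \<eta> n \<delta> F G x0 z t
           in lb_sgd_step m M \<sigma> b \<sigma>' \<eta> n \<delta>
                (\<lambda>i. batch_mean n (F i x) (z t)) (\<lambda>i. batch_mean n (G i x) (z t)) x)"

end

theory Submission
  imports Defs
begin

text \<open>A step from a feasible point stays feasible as soon as no constraint value deviates by more
  than its confidence radius and no constraint gradient by more than \<^emph>\<open>twice\<close> its radius: by
  smoothness the step size then keeps every constraint nonpositive along the whole segment.
  The failure probability \<open>\<delta>h\<close> pays for only one event of probability \<open>\<delta>\<close> per constraint and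
  iteration, so a union bound over value and gradient failures at level \<open>\<delta>\<close> would lose a
  factor 2. But exceeding twice the radius has probability at most \<open>\<delta> ^ 4\<close>, and as the last query
  point needs only \<open>T - 1\<close> steps, \<open>(T - 1) * m * (\<delta> + \<delta> ^ 4) \<le> m * T * \<delta> \<le> \<delta>h\<close>.\<close>

section \<open>Feasibility of a single step\<close>

lemma closed_feasible_set:
  assumes "\<And>i. i \<in> {1..m} \<Longrightarrow> continuous_on UNIV (f i)"
  shows "closed (feasible_set m f)"
proof -
  have "feasible_set m f = (\<Inter>i\<in>{1..m}. {x. f i x \<le> 0})"
    by (auto simp: feasible_set_def)
  then show ?thesis
    using assms by (auto intro!: closed_INT closed_Collect_le)
qed

text \<open>Put \<open>q = r * sqrt (\<alpha> * M)\<close>. Then q is at most \<alpha> and its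
  square is \<alpha> times the quadratic growth \<open>M * r^2\<close>, so that growth is at most q.
  This turns the step size rule, linear in the step length r, into a bound on the quadratic
  smoothness model.\<close>

lemma quadratic_le_of_step_size:
  fixes r \<theta> \<alpha> M :: real
  assumes "r \<ge> 0" "\<theta> \<ge> 0" "\<alpha> > 0" "M > 0" "r * (\<theta> + sqrt (\<alpha> * M)) \<le> \<alpha>"
  shows "\<theta> * r + M / 2 * r\<^sup>2 \<le> \<alpha>"
proof -
  define q where "q = r * sqrt (\<alpha> * M)"
  have q: "q \<ge> 0" "\<theta> * r + q \<le> \<alpha>" "q\<^sup>2 = \<alpha> * (M * r\<^sup>2)"
    using assms by (auto simp: q_def algebra_simps power_mult_distrib)
  have "q \<le> \<alpha>"
    using q(2) mult_nonneg_nonneg[OF assms(2,1)] by linarith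
  then have "\<alpha> * (M * r\<^sup>2) \<le> \<alpha> * q"
    using q(1,3) by (metis mult_right_mono power2_eq_square)
  then have "M * r\<^sup>2 \<le> q"
    using assms(3) by simp
  then show ?thesis
    using q(1,2) by simp
qed

text \<open>Smoothness is only available between feasible points, so the feasibility of the endpoint
  is not immediate: the feasible parameters in \<open>{0..<1}\<close> are closed, and they are open because
  the smoothness estimate makes every constraint strict there.\<close>

lemma feasible_set_add:
  fixes f :: "nat \<Rightarrow> real ^ 'd \<Rightarrow> real"
  assumes cont: "\<And>i. i \<in> {1..m} \<Longrightarrow> continuous_on UNIV (f i)"
    and smooth: "\<And>i. i \<in> {1..m} \<Longrightarrow> smooth_fun_on (M i) (feasible_set m f) (f i)"
    and M: "\<And>i. i \<in> {1..m} \<Longrightarrow> M i > 0"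
    and x: "x \<in> feasible_set m f"
    and \<alpha>: "\<And>i. i \<in> {1..m} \<Longrightarrow> \<alpha> i > 0" "\<And>i. i \<in> {1..m} \<Longrightarrow> f i x \<le> - \<alpha> i"
    and \<theta>: "\<And>i. i \<in> {1..m} \<Longrightarrow> \<theta> i \<ge> 0"
      "\<And>i. i \<in> {1..m} \<Longrightarrow> grad (f i) x \<bullet> v \<le> \<theta> i * norm v"
    and step: "\<And>i. i \<in> {1..m} \<Longrightarrow> norm v * (\<theta> i + sqrt (\<alpha> i * M i)) \<le> \<alpha> i"
  shows "x + v \<in> feasible_set m f"
proof -
  define X where "X = feasible_set m f"
  define U where "U = (\<Inter>i\<in>{1..m}. {y. f i y < 0})"
  define p where "p = (\<lambda>s::real. x + s *\<^sub>R v)"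
  have p: "continuous_on S p" for S
    unfolding p_def by (intro continuous_intros)
  have X: "closed X"
    unfolding X_def using cont by (rule closed_feasible_set)
  have U: "open U"
    unfolding U_def using cont by (auto intro!: open_INT open_Collect_less)
  have strict: "f i (p s) < 0" if s: "s \<in> {0..<1}" "p s \<in> X" and i: "i \<in> {1..m}" for s i
  proof -
    have "f i (p s) \<le> f i x + grad (f i) x \<bullet> (p s - x) + M i / 2 * (norm (p s - x))\<^sup>2"
      using smooth[OF i] s(2) x unfolding smooth_fun_on_def X_def by blast
    also have "\<dots> = f i x + s * (grad (f i) x \<bullet> v) + s * (s * (M i / 2 * (norm v)\<^sup>2))"
      by (simp add: p_def power_mult_distrib power2_eq_square)
    \<comment> \<open>Since \<open>s * s \<le> s\<close>, the quadratic term too is at most s times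
      its value at the full step. The strict sign at the end then comes from
      \<open>s < 1\<close>.\<close>
    also have "\<dots> \<le> - \<alpha> i + s * (\<theta> i * norm v) + s * (M i / 2 * (norm v)\<^sup>2)"
      using \<alpha>(2)[OF i] \<theta>(2)[OF i] s(1) M[OF i]
      by (intro add_mono mult_left_mono mult_left_le_one_le) auto
    also have "\<dots> = - \<alpha> i + s * (\<theta> i * norm v + M i / 2 * (norm v)\<^sup>2)"
      by (simp add: algebra_simps)
    also have "\<dots> \<le> - \<alpha> i + s * \<alpha> i"
      using quadratic_le_of_step_size[OF _ \<theta>(1)[OF i] \<alpha>(1)[OF i] M[OF i] step[OF i]] s(1)
      by (intro add_mono mult_left_mono) auto
    also have "\<dots> < 0"
      using s(1) \<alpha>(1)[OF i] by simp
    finally show ?thesis .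
  qed
  have UX: "U \<subseteq> X"
    by (auto simp: U_def X_def feasible_set_def less_imp_le)
  have eq: "{0..<1} \<inter> p -` X = {0..<1} \<inter> p -` U"
  proof
    show "{0..<1} \<inter> p -` X \<subseteq> {0..<1} \<inter> p -` U"
      using strict by (auto simp: U_def)
    show "{0..<1} \<inter> p -` U \<subseteq> {0..<1} \<inter> p -` X"
      using UX by auto
  qed
  have "closedin (top_of_set {0..<1}) ({0..<1} \<inter> p -` X)"
    using p X by (rule continuous_closedin_preimage)
  moreover have "openin (top_of_set {0..<1}) ({0..<1} \<inter> p -` X)"
    unfolding eq using p U by (rule continuous_openin_preimage_gen)
  moreover have "connected {0..<1::real}"
    by (simp add: convex_connected)
  ultimately have "{0..<1} \<inter> p -` X = {} \<or> {0..<1} \<inter> p -` X = {0..<1}"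
    unfolding connected_clopen by blast
  moreover have "0 \<in> {0..<1} \<inter> p -` X"
    using x by (simp add: p_def X_def)
  ultimately have "{0..<1} \<subseteq> p -` X"
    by blast
  \<comment> \<open>The endpoint \<open>s = 1\<close> is out of reach of \<open>strict\<close>;
    closedness of the preimage carries feasibility over to it.\<close>
  moreover have "closed (p -` X)"
    using continuous_closed_preimage[OF p closed_UNIV X] by simp
  ultimately have "closure {0..<1} \<subseteq> p -` X"
    by (rule closure_minimal)
  moreover have "1 \<in> closure {0..<1::real}"
    by simp
  ultimately have "p 1 \<in> X"
    by (metis subsetD vimageD)
  then show ?thesis
    by (simp add: p_def X_def)
qed

text \<open>The confidence radius grows like the square root of the logarithm, so the fourth power
  is the one that doubles it.\<close>

lemma sqrt_ln_inverse_power4: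
  assumes "0 < \<delta>" "\<delta> < 1"
  shows "sqrt (ln (1 / \<delta> ^ 4)) = 2 * sqrt (ln (1 / \<delta>))"
proof -
  have "ln (1 / \<delta> ^ 4) = 2\<^sup>2 * ln (1 / \<delta>)"
    using assms by (simp add: ln_div ln_realpow)
  then show ?thesis
    by (simp only: real_sqrt_mult real_sqrt_power) simp
qed

text \<open>The gradient estimate may be off by the radius belonging to \<open>\<delta> ^ 4\<close>, which is at most
  twice the one in \<open>\<theta>\<close>: the factor 2 before \<open>\<theta>\<close> in the step size absorbs this.\<close>

lemma lb_sgd_step_feasible:
  fixes f :: "nat \<Rightarrow> real ^ 'd \<Rightarrow> real"
  assumes m: "m \<ge> 1" and \<eta>: "\<eta> > 0" and \<delta>: "0 < \<delta>" "\<delta> < 1"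
    and cont: "\<And>i. i \<in> {1..m} \<Longrightarrow> continuous_on UNIV (f i)"
    and smooth: "\<And>i. i \<in> {1..m} \<Longrightarrow> smooth_fun_on (M i) (feasible_set m f) (f i)"
    and M: "\<And>i. i \<in> {0..m} \<Longrightarrow> M i > 0"
    and nonneg: "\<And>i. i \<in> {1..m} \<Longrightarrow> b i \<ge> 0 \<and> \<sigma>' i \<ge> 0"
    and x: "x \<in> feasible_set m f"
    and Fn: "\<And>i. i \<in> {1..m} \<Longrightarrow>
      norm (Fn i - f i x) \<le> \<sigma> i / sqrt (real n) * sqrt (ln (1 / \<delta>))"
    and Gn: "\<And>i. i \<in> {1..m} \<Longrightarrow>
      norm (Gn i - grad (f i) x) \<le> b i + \<sigma>' i / sqrt (real n) * sqrt (ln (1 / \<delta> ^ 4))"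
  shows "lb_sgd_step m M \<sigma> b \<sigma>' \<eta> n \<delta> Fn Gn x \<in> feasible_set m f"
proof -
  define \<alpha> where "\<alpha> = (\<lambda>i. - Fn i - \<sigma> i / sqrt (real n) * sqrt (ln (1 / \<delta>)))"
  define g where "g = Gn 0 + \<eta> *\<^sub>R (\<Sum>i=1..m. Gn i /\<^sub>R (- Fn i))"
  define w where "w = (\<lambda>i. b i + \<sigma>' i / sqrt (real n) * sqrt (ln (1 / \<delta>)))"
  define \<theta> where "\<theta> = (\<lambda>i. \<bar>Gn i \<bullet> (g /\<^sub>R norm g)\<bar> + w i)"
  define M2 where "M2 = M 0 + 10 * \<eta> * (\<Sum>i=1..m. M i / \<alpha> i)
    + 8 * \<eta> * (\<Sum>i=1..m. (\<theta> i)\<^sup>2 / (\<alpha> i)\<^sup>2)"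
  define q where "q = (\<lambda>i. \<alpha> i / (2 * \<bar>\<theta> i\<bar> + sqrt (\<alpha> i * M i)))"
  define \<gamma> where "\<gamma> = (if \<exists>i\<in>{1..m}. \<alpha> i \<le> 0 then 0
    else min ((MIN i\<in>{1..m}. q i) * (1 / norm g)) (1 / M2))"
  \<comment> \<open>The displacement is written as an added vector so that
    \<open>feasible_set_add\<close> applies with it as v.\<close>
  have eq: "lb_sgd_step m M \<sigma> b \<sigma>' \<eta> n \<delta> Fn Gn x = x + (- (\<gamma> *\<^sub>R g))"
    unfolding lb_sgd_step_def Let_def \<gamma>_def q_def M2_def \<theta>_def w_def \<alpha>_def g_def
    by (simp add: add.assoc)
  show ?thesis
  proof (cases "(\<exists>i\<in>{1..m}. \<alpha> i \<le> 0) \<or> g = 0")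
    case True
    then show ?thesis
      using x unfolding eq \<gamma>_def by auto
  next
    case False
    then have \<alpha>: "\<alpha> i > 0" if "i \<in> {1..m}" for i
      using that by force
    have g: "g \<noteq> 0"
      using False by blast
    have ln: "ln (1 / \<delta>) \<ge> 0"
      using \<delta> by simp
    have w: "w i \<ge> 0" if "i \<in> {1..m}" for i
      using nonneg[OF that] ln by (auto simp: w_def)
    have \<theta>: "\<theta> i \<ge> 0" if "i \<in> {1..m}" for i
      using w[OF that] by (simp add: \<theta>_def)
    have q: "q i > 0" if "i \<in> {1..m}" for i
      using \<alpha>[OF that] M[of i] that by (auto simp: q_def intro!: divide_pos_pos add_nonneg_pos)
    have "M i / \<alpha> i \<ge> 0" if "i \<in> {1..m}" for i
      using \<alpha>[OF that] M[of i] that by (simp add: less_imp_le)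
    \<comment> \<open>Positivity of \<open>M2\<close> keeps \<gamma> nonnegative, so that the step
      length is \<open>\<gamma> * norm g\<close>.\<close>
    then have "M2 > 0"
      unfolding M2_def using M[of 0] \<eta>
      by (intro add_pos_nonneg mult_nonneg_nonneg sum_nonneg) auto
    moreover have "(MIN i\<in>{1..m}. q i) > 0"
      using q m by (subst Min_gr_iff) auto
    ultimately have \<gamma>: "\<gamma> \<ge> 0" "\<gamma> \<le> (MIN i\<in>{1..m}. q i) * (1 / norm g)"
      using False by (auto simp: \<gamma>_def)
    have norm_v: "norm (- (\<gamma> *\<^sub>R g)) = \<gamma> * norm g"
      using \<gamma>(1) by simp
    have le_q: "\<gamma> * norm g \<le> q i" if "i \<in> {1..m}" for i
    proof -
      have "\<gamma> * norm g \<le> (MIN i\<in>{1..m}. q i)"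
        using \<gamma>(2) g by (simp add: field_simps)
      also have "\<dots> \<le> q i"
        using that by (intro Min_le) auto
      finally show ?thesis .
    qed
    have "x + (- (\<gamma> *\<^sub>R g)) \<in> feasible_set m f"
    proof (rule feasible_set_add[where M = M and \<alpha> = \<alpha> and \<theta> = "\<lambda>i. 2 * \<theta> i"])
      fix i assume i: "i \<in> {1..m}"
      show "M i > 0"
        using M i by simp
      show "f i x \<le> - \<alpha> i"
        using Fn[OF i] by (simp add: \<alpha>_def abs_le_iff)
      show "2 * \<theta> i \<ge> 0"
        using \<theta>[OF i] by simp
      \<comment> \<open>Passing from \<delta> to \<open>\<delta> ^ 4\<close> doubles only the
        sub-Gaussian part of the radius; the bias is nonnegative, so it may be doubled as
        well.\<close>
      have "norm (Gn i - grad (f i) x) \<le> 2 * w i"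
        using Gn[OF i] nonneg[OF i] unfolding sqrt_ln_inverse_power4[OF \<delta>] w_def
        by (simp add: algebra_simps)
      moreover have "norm (g /\<^sub>R norm g) = 1"
        using g by simp
      ultimately have "\<bar>(Gn i - grad (f i) x) \<bullet> (g /\<^sub>R norm g)\<bar> \<le> 2 * w i"
        using Cauchy_Schwarz_ineq2[of "Gn i - grad (f i) x" "g /\<^sub>R norm g"] by simp
      \<comment> \<open>Here c stands for the estimated and a for the true slope of the constraint
        along the unit vector of g: \<open>- a = (c - a) - c\<close> is at most
        \<open>2 * w i + \<bar>c\<bar>\<close>. The sign is negative because the step goes against
        g.\<close>
      moreover have "- a \<le> 2 * (\<bar>c\<bar> + w i)" if "\<bar>c - a\<bar> \<le> 2 * w i" for a c
        using that abs_ge_minus_self[of c] abs_ge_zero[of c] unfolding abs_le_iff by argo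
      ultimately have "- (grad (f i) x \<bullet> (g /\<^sub>R norm g)) \<le> 2 * \<theta> i"
        unfolding \<theta>_def inner_diff_left by blast
      then have "\<gamma> * (norm g * - (grad (f i) x \<bullet> (g /\<^sub>R norm g))) \<le> \<gamma> * (norm g * (2 * \<theta> i))"
        using \<gamma>(1) by (intro mult_left_mono) auto
      also have "norm g * - (grad (f i) x \<bullet> (g /\<^sub>R norm g)) = - (grad (f i) x \<bullet> g)"
        using g by simp
      finally show "grad (f i) x \<bullet> - (\<gamma> *\<^sub>R g) \<le> 2 * \<theta> i * norm (- (\<gamma> *\<^sub>R g))"
        unfolding norm_v by (simp add: mult_ac)
      have "2 * \<bar>\<theta> i\<bar> + sqrt (\<alpha> i * M i) > 0"
        using \<alpha>[OF i] M[of i] i by (intro add_nonneg_pos) auto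
      then show "norm (- (\<gamma> *\<^sub>R g)) * (2 * \<theta> i + sqrt (\<alpha> i * M i)) \<le> \<alpha> i"
        using le_q[OF i] \<theta>[OF i] unfolding norm_v q_def by (simp add: pos_le_divide_eq)
    qed (use cont smooth x \<alpha> in auto)
    then show ?thesis
      unfolding eq .
  qed
qed

section \<open>Measurability of the query points and their dependence on past noise\<close>

text \<open>Differentiability does not make the gradient continuous. Each component is however the
  pointwise limit of difference quotients with steps \<open>h k\<close>, and these are continuous in
  the base point.\<close>

lemma borel_measurable_grad:
  fixes f :: "real ^ 'd \<Rightarrow> real"
  assumes "\<And>x. f differentiable (at x)"
  shows "grad f \<in> borel_measurable borel"
proof (subst borel_measurable_euclidean_space, intro ballI)
  fix e :: "real ^ 'd"
  define h where "h = (\<lambda>k. inverse (real (Suc k)))"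
  have cont: "continuous_on UNIV f"
    using assms by (simp add: differentiable_imp_continuous_on differentiable_on_def
        differentiable_at_withinI)
  have "(\<lambda>k. (f (x + h k *\<^sub>R e) - f x) / h k) \<longlonglongrightarrow> grad f x \<bullet> e" for x
  proof -
    have "((\<lambda>t::real. f (x + t *\<^sub>R e)) has_derivative (\<lambda>t. (t *\<^sub>R e) \<bullet> grad f x)) (at 0)"
      by (rule has_derivative_compose[where g = f, of "\<lambda>t. x + t *\<^sub>R e" "\<lambda>t. t *\<^sub>R e"])
        (use GDERIV_grad[OF assms] in \<open>auto simp: gderiv_def intro!: derivative_eq_intros\<close>)
    then have "((\<lambda>t::real. f (x + t *\<^sub>R e)) has_field_derivative grad f x \<bullet> e) (at 0)"
      by (simp add: has_field_derivative_def inner_commute mult.commute[of _ "_ \<bullet> _"])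
    then have "((\<lambda>t. (f (x + t *\<^sub>R e) - f x) / t) \<longlongrightarrow> grad f x \<bullet> e) (at 0)"
      by (simp add: has_field_derivative_iff)
    moreover have "filterlim h (at 0) sequentially"
      unfolding h_def by (rule filterlim_atI[OF LIMSEQ_inverse_real_of_nat]) simp
    ultimately show ?thesis
      by (rule filterlim_compose)
  qed
  moreover have "(\<lambda>x. (f (x + h k *\<^sub>R e) - f x) / h k) \<in> borel_measurable borel" for k
    using cont
    by (intro borel_measurable_continuous_onI continuous_intros continuous_on_compose2[OF cont])
      (auto simp: h_def)
  ultimately show "(\<lambda>x. grad f x \<bullet> e) \<in> borel_measurable borel"
    by (rule borel_measurable_LIMSEQ_real)
qed

lemma measurable_batch_mean:
  fixes H :: "'a::topological_space \<Rightarrow> 'z \<Rightarrow> 'b::{real_normed_vector,second_countable_topology}"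
  assumes H: "case_prod H \<in> borel_measurable (borel \<Otimes>\<^sub>M D)"
    and X: "X \<in> borel_measurable N"
    and Z: "\<And>k. k < n \<Longrightarrow> (\<lambda>w. Z w k) \<in> measurable N D"
  shows "(\<lambda>w. batch_mean n (H (X w)) (Z w)) \<in> borel_measurable N"
proof -
  have "(\<lambda>w. H (X w) (Z w k)) \<in> borel_measurable N" if "k < n" for k
    using measurable_compose[OF measurable_Pair[OF X Z[OF that]] H] by simp
  then show ?thesis
    unfolding batch_mean_def by (intro borel_measurable_scaleR borel_measurable_sum) auto
qed

lemma measurable_lb_sgd_step:
  assumes Fn: "\<And>i. i \<in> {0..m} \<Longrightarrow> (\<lambda>w. Fn w i) \<in> borel_measurable N"
    and Gn: "\<And>i. i \<in> {0..m} \<Longrightarrow> (\<lambda>w. Gn w i) \<in> borel_measurable N"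
    and x: "x \<in> borel_measurable N"
  shows "(\<lambda>w. lb_sgd_step m M \<sigma> b \<sigma>' \<eta> n \<delta> (Fn w) (Gn w) (x w)) \<in> borel_measurable N"
proof -
  note Fn' [measurable] = Fn[simplified] and Gn' [measurable] = Gn[simplified] and x [measurable]
  show ?thesis
    unfolding lb_sgd_step_def Let_def by measurable
qed

text \<open>Measurability is asked only of the samples from iterations before t. The result thus
  serves both on the whole probability space and on a finite product that holds just the past
  samples.\<close>

lemma measurable_lb_sgd:
  fixes F :: "nat \<Rightarrow> real ^ 'd \<Rightarrow> 'z \<Rightarrow> real"
  assumes F: "\<And>i. i \<in> {0..m} \<Longrightarrow> case_prod (F i) \<in> borel_measurable (borel \<Otimes>\<^sub>M D)"
    and G: "\<And>i. i \<in> {0..m} \<Longrightarrow> case_prod (G i) \<in> borel_measurable (borel \<Otimes>\<^sub>M D)"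
    and Z: "\<And>s k. s \<in> {1..<t} \<Longrightarrow> k < n \<Longrightarrow> (\<lambda>w. Z w s k) \<in> measurable N D"
  shows "(\<lambda>w. lb_sgd m M \<sigma> b \<sigma>' \<eta> n \<delta> F G x0 (Z w) t) \<in> borel_measurable N"
  using Z
proof (induction t)
  case 0
  then show ?case by simp
next
  case (Suc t)
  show ?case
  proof (cases "t = 0")
    case False
    have IH: "(\<lambda>w. lb_sgd m M \<sigma> b \<sigma>' \<eta> n \<delta> F G x0 (Z w) t) \<in> borel_measurable N"
      using Suc by simp
    have Z: "\<And>k. k < n \<Longrightarrow> (\<lambda>w. Z w t k) \<in> measurable N D"
      using Suc.prems False by simp
    show ?thesis
      using False F G by (auto simp: Let_def
          intro!: measurable_lb_sgd_step measurable_batch_mean[OF _ IH] Z IH)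
  qed simp
qed

lemma batch_mean_cong:
  "(\<And>k. k < n \<Longrightarrow> z k = z' k) \<Longrightarrow> batch_mean n h z = batch_mean n h z'"
  by (simp add: batch_mean_def)

text \<open>The query points are adapted: the batch of iteration t is drawn after the t-th point is
  fixed. This allows the full noise to be replaced by its restriction to past indices.\<close>

lemma lb_sgd_cong:
  fixes z :: "nat \<Rightarrow> nat \<Rightarrow> 'a" and x0 :: "real ^ 'b"
  assumes "\<And>s k. s \<in> {1..<t} \<Longrightarrow> k < n \<Longrightarrow> z s k = z' s k"
  shows "lb_sgd m M \<sigma> b \<sigma>' \<eta> n \<delta> F G x0 z t = lb_sgd m M \<sigma> b \<sigma>' \<eta> n \<delta> F G x0 z' t"
  using assms
proof (induction t)
  case (Suc t)
  show ?case
  proof (cases "t = 0")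
    case False
    then have "batch_mean n h (z t) = batch_mean n h (z' t)" for h :: "'a \<Rightarrow> real"
      using Suc.prems by (intro batch_mean_cong) auto
    moreover have "batch_mean n h (z t) = batch_mean n h (z' t)" for h :: "'a \<Rightarrow> real ^ 'b"
      using Suc.prems False by (intro batch_mean_cong) auto
    ultimately show ?thesis
      using Suc by simp
  qed simp
qed simp

section \<open>Independence, union bounds and deviation bounds at random query points\<close>

text \<open>By independence the joint law is the product of the two laws, so the probability is the
  integral over x of the probabilities of the sections, each at least p.\<close>

lemma (in prob_space) indep_var_prob_ge:
  assumes ind: "indep_var N X K Y"
    and A [measurable]: "Measurable.pred (N \<Otimes>\<^sub>M K) (case_prod A)"
    and p: "\<And>x. x \<in> space N \<Longrightarrow> \<P>(y in distr M K Y. A x y) \<ge> p"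
  shows "\<P>(w in M. A (X w) (Y w)) \<ge> p"
proof -
  have X [measurable]: "random_variable N X" and Y [measurable]: "random_variable K Y"
    using indep_var_rv1[OF ind] indep_var_rv2[OF ind] .
  interpret X: prob_space "distr M N X"
    using X by (rule prob_space_distr)
  interpret Y: prob_space "distr M K Y"
    using Y by (rule prob_space_distr)
  let ?A = "{z \<in> space (N \<Otimes>\<^sub>M K). case_prod A z}"
  have sets: "?A \<in> sets (distr M N X \<Otimes>\<^sub>M distr M K Y)"
  proof -
    have "?A \<in> sets (N \<Otimes>\<^sub>M K)"
      by measurable
    also have "sets (N \<Otimes>\<^sub>M K) = sets (distr M N X \<Otimes>\<^sub>M distr M K Y)"
      by (intro sets_pair_measure_cong) auto
    finally show ?thesis .
  qed
  have "ennreal p = (\<integral>\<^sup>+x. ennreal p \<partial>distr M N X)"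
    using X.emeasure_space_1 by simp
  also have "\<dots> \<le> (\<integral>\<^sup>+x. emeasure (distr M K Y) (Pair x -` ?A) \<partial>distr M N X)"
  proof (rule nn_integral_mono)
    fix x assume x: "x \<in> space (distr M N X)"
    then have "Pair x -` ?A = {y \<in> space (distr M K Y). A x y}"
      by (auto simp: space_pair_measure)
    then show "ennreal p \<le> emeasure (distr M K Y) (Pair x -` ?A)"
      using p[of x] x by (simp add: Y.emeasure_eq_measure ennreal_leI)
  qed
  also have "\<dots> = emeasure (distr M N X \<Otimes>\<^sub>M distr M K Y) ?A"
    using sets by (rule Y.emeasure_pair_measure_alt[symmetric])
  also have "\<dots> = emeasure (distr M (N \<Otimes>\<^sub>M K) (\<lambda>w. (X w, Y w))) ?A"
    using ind by (simp add: indep_var_distribution_eq)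
  also have "\<dots> = emeasure M {w \<in> space M. A (X w) (Y w)}"
    using measurable_space[OF X] measurable_space[OF Y]
    by (subst emeasure_distr)
      (auto intro!: arg_cong2[where f = emeasure] simp: space_pair_measure)
  finally show ?thesis
    by (simp add: emeasure_eq_measure)
qed

text \<open>The union bound, applied to the complements.\<close>

lemma (in prob_space) prob_all_ge_diff_sum:
  assumes "finite I" and E: "\<And>i. i \<in> I \<Longrightarrow> Measurable.pred M (E i)"
    and p: "\<And>i. i \<in> I \<Longrightarrow> \<P>(w in M. E i w) \<ge> 1 - p i"
  shows "\<P>(w in M. \<forall>i\<in>I. E i w) \<ge> 1 - (\<Sum>i\<in>I. p i)"
proof -
  note E' [measurable] = E
  have [measurable]: "{w \<in> space M. \<not> E i w} \<in> events" if "i \<in> I" for i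
    using that by measurable
  have "1 - \<P>(w in M. \<forall>i\<in>I. E i w) = \<P>(w in M. \<not> (\<forall>i\<in>I. E i w))"
    using assms(1) by (intro prob_neg[symmetric]) measurable
  also have "{w \<in> space M. \<not> (\<forall>i\<in>I. E i w)} = (\<Union>i\<in>I. {w \<in> space M. \<not> E i w})"
    by auto
  also have "prob \<dots> \<le> (\<Sum>i\<in>I. \<P>(w in M. \<not> E i w))"
    using assms(1) by (intro finite_measure_subadditive_finite) auto
  also have "\<dots> \<le> (\<Sum>i\<in>I. p i)"
  proof (rule sum_mono)
    fix i assume i: "i \<in> I"
    have "\<P>(w in M. \<not> E i w) = 1 - \<P>(w in M. E i w)"
      using predE[OF E[OF i]] by (rule prob_neg)
    with p[OF i] show "\<P>(w in M. \<not> E i w) \<le> p i"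
      by simp
  qed
  finally show ?thesis
    by simp
qed

text \<open>Leaving out one of T iterations saves \<open>m * \<delta>\<close>. That pays for all
  gradient failures, because \<open>T * \<delta> \<le> 1\<close> gives
  \<open>m * T * \<delta> ^ 4 \<le> m * \<delta>\<close>.\<close>

lemma failure_budget:
  fixes m T :: nat
  assumes "m \<ge> 1" "T \<ge> 1" "0 < \<delta>" "\<delta> \<le> \<delta>h / (real m * real T)" "\<delta>h < 1"
  shows "(real T - 1) * (real m * (\<delta> + \<delta> ^ 4)) \<le> \<delta>h"
proof -
  have "real m * real T * \<delta> \<le> \<delta>h"
    using assms by (simp add: field_simps)
  moreover have "real T * \<delta> \<le> real m * real T * \<delta>"
    using assms by simp
  ultimately have le: "real m * real T * \<delta> \<le> \<delta>h" "real T * \<delta> \<le> 1" 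
    using assms by linarith+
  have "1 * \<delta> \<le> real T * \<delta>"
    using assms by (intro mult_right_mono) auto
  then have "\<delta> \<le> 1"
    using le by linarith
  then have "\<delta> * \<delta> * (real T * \<delta>) \<le> 1"
    using le \<open>\<delta> \<le> 1\<close> assms by (intro mult_le_one[of "\<delta> * \<delta>" "real T * \<delta>"] mult_le_one[of \<delta> \<delta>]) auto
  then have "real m * \<delta> * (\<delta> * \<delta> * (real T * \<delta>)) \<le> real m * \<delta>"
    using assms by (intro mult_left_le) auto
  moreover have "real m * \<delta> ^ 4 \<ge> 0"
    using assms by simp
  ultimately show ?thesis
    using le(1) by (simp add: algebra_simps power4_eq_xxxx)
qed

text \<open>Independence is available for raw families of samples, the probability bound for the law
  of a reshaped one. In the application \<phi> sends past noise to the query point and \<psi>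
  reindexes the current batch.\<close>

lemma (in prob_space) indep_var_compose_prob_ge:
  assumes ind: "indep_var N X K Y"
    and \<phi> [measurable]: "\<phi> \<in> measurable N N'" and \<psi> [measurable]: "\<psi> \<in> measurable K K'"
    and A [measurable]: "Measurable.pred (N' \<Otimes>\<^sub>M K') (case_prod A)"
    and p: "\<And>x. x \<in> space N' \<Longrightarrow> \<P>(y in distr M K' (\<lambda>w. \<psi> (Y w)). A x y) \<ge> p"
  shows "\<P>(w in M. A (\<phi> (X w)) (\<psi> (Y w))) \<ge> p"
proof (rule indep_var_prob_ge[OF ind, where A = "\<lambda>x y. A (\<phi> x) (\<psi> y)"])
  have "(\<lambda>z. (\<phi> (fst z), \<psi> (snd z))) \<in> measurable (N \<Otimes>\<^sub>M K) (N' \<Otimes>\<^sub>M K')"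
    by measurable
  from measurable_compose[OF this A]
  show "Measurable.pred (N \<Otimes>\<^sub>M K) (\<lambda>(x, y). A (\<phi> x) (\<psi> y))"
    by (simp add: case_prod_beta)
next
  fix x assume "x \<in> space N"
  then have x: "\<phi> x \<in> space N'"
    by (rule measurable_space[OF \<phi>])
  have Y [measurable]: "random_variable K Y"
    by (rule indep_var_rv2[OF ind])
  have A' [measurable]: "Measurable.pred K' (A (\<phi> x))"
    using measurable_compose[OF measurable_Pair1'[OF x] A] by simp
  have "\<P>(y in distr M K Y. A (\<phi> x) (\<psi> y)) = \<P>(w in M. A (\<phi> x) (\<psi> (Y w)))"
    using measurable_space[OF Y]
    by (subst measure_distr) (auto intro!: arg_cong[where f = prob])
  also have "\<dots> = \<P>(y in distr M K' (\<lambda>w. \<psi> (Y w)). A (\<phi> x) y)"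
    using measurable_space[OF Y] measurable_space[OF \<psi>]
    by (subst measure_distr) (auto intro!: arg_cong[where f = prob])
  finally show "\<P>(y in distr M K Y. A (\<phi> x) (\<psi> y)) \<ge> p"
    using p[OF x] by simp
qed

text \<open>All samples together have the product law, and one batch is their image under the
  injective reindexing \<open>k \<mapsto> (t, k)\<close>; such an image of a product measure is
  again a product.\<close>

lemma (in prob_space) distr_indep_vars_block:
  fixes \<xi> :: "nat \<Rightarrow> nat \<Rightarrow> 'a \<Rightarrow> 'z"
  assumes noise: "prob_space D" and n: "n \<ge> 1"
    and indep: "indep_vars (\<lambda>_. D) (\<lambda>(t, k). \<xi> t k) ({1..T} \<times> {..<n})"
    and distr: "\<And>t k. t \<in> {1..T} \<Longrightarrow> k < n \<Longrightarrow> distr M D (\<xi> t k) = D"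
    and t: "t \<in> {1..T}"
  shows "distr M (\<Pi>\<^sub>M k\<in>{..<n}. D) (\<lambda>w. \<lambda>k\<in>{..<n}. \<xi> t k w) = (\<Pi>\<^sub>M k\<in>{..<n}. D)"
proof -
  define J where "J = {1..T} \<times> {..<n}"
  define \<zeta> where "\<zeta> = (\<lambda>(t, k). \<xi> t k)"
  have ind: "indep_vars (\<lambda>_. D) \<zeta> J"
    using indep by (simp add: J_def \<zeta>_def)
  have rv: "random_variable D (\<zeta> j)" if "j \<in> J" for j
    using ind that by (auto simp: indep_vars_def)
  \<comment> \<open>The characterization of independence by the product law is for a nonempty index
    set; this is where \<open>n \<ge> 1\<close> enters.\<close>
  have "(t, 0) \<in> J"
    using t n by (simp add: J_def)
  then have "J \<noteq> {}"
    by blast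
  then have "distr M (\<Pi>\<^sub>M j\<in>J. D) (\<lambda>w. \<lambda>j\<in>J. \<zeta> j w) = (\<Pi>\<^sub>M j\<in>J. distr M D (\<zeta> j))"
    using ind rv by (subst (asm) indep_vars_iff_distr_eq_PiM') auto
  also have "\<dots> = (\<Pi>\<^sub>M j\<in>J. D)"
    by (intro PiM_cong) (auto simp: J_def \<zeta>_def distr)
  finally have J: "distr M (\<Pi>\<^sub>M j\<in>J. D) (\<lambda>w. \<lambda>j\<in>J. \<zeta> j w) = (\<Pi>\<^sub>M j\<in>J. D)" .
  have "distr M (\<Pi>\<^sub>M k\<in>{..<n}. D) (\<lambda>w. \<lambda>k\<in>{..<n}. \<xi> t k w) =
      distr M (\<Pi>\<^sub>M k\<in>{..<n}. D) ((\<lambda>z. \<lambda>k\<in>{..<n}. z (t, k)) \<circ> (\<lambda>w. \<lambda>j\<in>J. \<zeta> j w))"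
    using t by (intro distr_cong) (auto simp: J_def \<zeta>_def fun_eq_iff)
  also have "\<dots> = distr (distr M (\<Pi>\<^sub>M j\<in>J. D) (\<lambda>w. \<lambda>j\<in>J. \<zeta> j w))
      (\<Pi>\<^sub>M k\<in>{..<n}. D) (\<lambda>z. \<lambda>k\<in>{..<n}. z (t, k))"
    by (subst distr_distr)
      (use t rv in \<open>auto intro!: measurable_restrict measurable_component_singleton simp: J_def\<close>)
  also have "\<dots> = (\<Pi>\<^sub>M k\<in>{..<n}. D)"
    unfolding J using distr_PiM_reindex[of J "\<lambda>_. D" "\<lambda>k. (t, k)" "{..<n}"] noise t
    by (auto simp: J_def inj_on_def)
  finally show ?thesis .
qed

text \<open>The query point is a function of the earlier batches and hence independent of the current
  one, so the deviation bound for fixed query points carries over.\<close>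

lemma prob_batch_mean_lb_sgd:
  fixes \<xi> :: "nat \<Rightarrow> nat \<Rightarrow> 'w \<Rightarrow> 'z"
    and F :: "nat \<Rightarrow> real ^ 'd \<Rightarrow> 'z \<Rightarrow> real"
    and H :: "real ^ 'd \<Rightarrow> 'z \<Rightarrow> 'b::{real_normed_vector,second_countable_topology}"
  assumes prob: "prob_space P" and noise: "prob_space D" and n: "n \<ge> 1"
    and indep: "prob_space.indep_vars P (\<lambda>_. D) (\<lambda>(t, k). \<xi> t k) ({1..T} \<times> {..<n})"
    and distr: "\<And>t k. t \<in> {1..T} \<Longrightarrow> k < n \<Longrightarrow> distr P D (\<xi> t k) = D"
    and F: "\<And>i. i \<in> {0..m} \<Longrightarrow> case_prod (F i) \<in> borel_measurable (borel \<Otimes>\<^sub>M D)"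
    and G: "\<And>i. i \<in> {0..m} \<Longrightarrow> case_prod (G i) \<in> borel_measurable (borel \<Otimes>\<^sub>M D)"
    and t: "t \<in> {1..T}"
    and H: "case_prod H \<in> borel_measurable (borel \<Otimes>\<^sub>M D)"
    and c: "c \<in> borel_measurable borel"
    and sub: "\<And>x. sub_gaussian_means D (H x) (c x) B s"
    and \<epsilon>: "0 < \<epsilon>" "\<epsilon> < 1"
    and x: "\<And>w. x w = lb_sgd m M \<sigma> b \<sigma>' \<eta> n \<delta> F G x0 (\<lambda>t k. \<xi> t k w) t"
  shows "\<P>(w in P. norm (batch_mean n (H (x w)) (\<lambda>k. \<xi> t k w) - c (x w))
      \<le> B + s / sqrt (real n) * sqrt (ln (1 / \<epsilon>))) \<ge> 1 - \<epsilon>" (is "?p \<ge> _")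
proof -
  interpret prob_space P
    by (rule prob)
  define \<zeta> where "\<zeta> = (\<lambda>(t, k). \<xi> t k)"
  \<comment> \<open>Sample indices are split by iteration. For \<open>t = 1\<close> the set
    \<open>past\<close> is empty and the query point is constant.\<close>
  define past where "past = {1..<t} \<times> {..<n}"
  define now where "now = {t} \<times> {..<n}"
  define K where "K = (\<Pi>\<^sub>M k\<in>{..<n}. D)"
  define \<phi> where "\<phi> = (\<lambda>z. lb_sgd m M \<sigma> b \<sigma>' \<eta> n \<delta> F G x0 (\<lambda>s k. z (s, k)) t)"
  define \<psi> where "\<psi> = (\<lambda>z::nat \<times> nat \<Rightarrow> 'z. \<lambda>k\<in>{..<n}. z (t, k))"
  define A where "A = (\<lambda>x y. norm (batch_mean n (H x) y - c x)
    \<le> B + s / sqrt (real n) * sqrt (ln (1 / \<epsilon>)))"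
  have x_eq: "\<phi> (\<lambda>j\<in>past. \<zeta> j w) = x w" for w
    unfolding \<phi>_def x by (intro lb_sgd_cong) (auto simp: past_def \<zeta>_def)
  have y_eq: "\<psi> (\<lambda>j\<in>now. \<zeta> j w) = (\<lambda>k\<in>{..<n}. \<xi> t k w)" for w
    by (auto simp: \<psi>_def now_def \<zeta>_def fun_eq_iff)
  have block: "distr P K (\<lambda>w. \<psi> (\<lambda>j\<in>now. \<zeta> j w)) = K"
    unfolding y_eq K_def by (rule distr_indep_vars_block[OF noise n indep distr t])
  have [measurable]: "(\<lambda>w. batch_mean n (H (fst w)) (snd w)) \<in> borel_measurable (borel \<Otimes>\<^sub>M K)"
    unfolding K_def using H by (rule measurable_batch_mean) auto
  note c [measurable]
  have "\<P>(w in P. A (\<phi> (\<lambda>j\<in>past. \<zeta> j w)) (\<psi> (\<lambda>j\<in>now. \<zeta> j w))) \<ge> 1 - \<epsilon>"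
  proof (rule indep_var_compose_prob_ge[where A = A and \<phi> = \<phi> and \<psi> = \<psi>])
    show "indep_var (\<Pi>\<^sub>M j\<in>past. D) (\<lambda>w. \<lambda>j\<in>past. \<zeta> j w) (\<Pi>\<^sub>M j\<in>now. D) (\<lambda>w. \<lambda>j\<in>now. \<zeta> j w)"
      using indep unfolding \<zeta>_def
      by (rule indep_var_restrict) (use t in \<open>auto simp: past_def now_def\<close>)
    show "\<phi> \<in> borel_measurable (\<Pi>\<^sub>M j\<in>past. D)"
      unfolding \<phi>_def using F G by (rule measurable_lb_sgd) (auto simp: past_def)
    show "\<psi> \<in> measurable (\<Pi>\<^sub>M j\<in>now. D) K"
      unfolding \<psi>_def K_def by (rule measurable_restrict) (auto simp: now_def)
    show "Measurable.pred (borel \<Otimes>\<^sub>M K) (case_prod A)"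
      unfolding A_def case_prod_beta by measurable
    \<comment> \<open>By \<open>block\<close> the reindexed batch has law \<open>K\<close>, the very
      measure for which \<open>sub_gaussian_means\<close> states its bound at a fixed point.\<close>
    show "\<P>(y in distr P K (\<lambda>w. \<psi> (\<lambda>j\<in>now. \<zeta> j w)). A x y) \<ge> 1 - \<epsilon>" for x
      unfolding block unfolding A_def K_def using sub[of x] n \<epsilon> by (simp add: sub_gaussian_means_def)
  qed
  \<comment> \<open>The law concerns the batch cut off at index n, and the mean reads no index
    beyond.\<close>
  moreover have "batch_mean n h (\<lambda>k\<in>{..<n}. \<xi> t k w) = batch_mean n h (\<lambda>k. \<xi> t k w)"
    for h :: "'z \<Rightarrow> 'b" and w
    by (rule batch_mean_cong) simp
  then have "\<P>(w in P. A (\<phi> (\<lambda>j\<in>past. \<zeta> j w)) (\<psi> (\<lambda>j\<in>now. \<zeta> j w))) = ?p"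
    by (simp add: x_eq y_eq A_def)
  ultimately show ?thesis
    by simp
qed

section \<open>Feasibility of all query points with high probability\<close>

theorem theorem4:
  fixes f :: "nat \<Rightarrow> real ^ 'd \<Rightarrow> real"
    and m n T :: nat
    and L M \<sigma> b \<sigma>' :: "nat \<Rightarrow> real"
    and R \<beta> \<rho> l \<eta> \<delta> \<delta>h :: real
    and x0 :: "real ^ 'd"
    and D :: "'z measure" and P :: "'w measure"
    and F :: "nat \<Rightarrow> real ^ 'd \<Rightarrow> 'z \<Rightarrow> real"
    and G :: "nat \<Rightarrow> real ^ 'd \<Rightarrow> 'z \<Rightarrow> real ^ 'd"
    and \<xi> :: "nat \<Rightarrow> nat \<Rightarrow> 'w \<Rightarrow> 'z"
  assumes m: "m \<ge> 1"
    and diff: "\<And>i x. i \<in> {0..m} \<Longrightarrow> f i differentiable (at x)"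
    and diam: "\<And>x y. x \<in> feasible_set m f \<Longrightarrow> y \<in> feasible_set m f \<Longrightarrow> norm (x - y) \<le> R"
    and pos: "\<And>i. i \<in> {0..m} \<Longrightarrow> L i > 0 \<and> M i > 0"
    and smooth: "\<And>i. i \<in> {0..m} \<Longrightarrow> smooth_fun_on (M i) (feasible_set m f) (f i)"
    and lipschitz: "\<And>i. i \<in> {0..m} \<Longrightarrow> (L i)-lipschitz_on (feasible_set m f) (f i)"
    and x0: "x0 \<in> feasible_set m f" "(MAX i\<in>{1..m}. f i x0) \<le> - \<beta>" "\<beta> > 0"
    and mfcq: "0 < \<rho>" "\<rho> \<le> \<beta> / 2" "l > 0" "ext_mfcq m f \<rho> l"
    and noise: "prob_space D"
    and nonneg: "\<And>i. i \<in> {0..m} \<Longrightarrow> \<sigma> i \<ge> 0 \<and> b i \<ge> 0 \<and> \<sigma>' i \<ge> 0"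
    and value_orc: "\<And>i. i \<in> {0..m} \<Longrightarrow> value_oracle D (f i) (\<sigma> i) (F i)"
    and gradient_orc: "\<And>i. i \<in> {0..m} \<Longrightarrow> gradient_oracle D (f i) (b i) (\<sigma>' i) (G i)"
    and prob: "prob_space P"
    and indep: "prob_space.indep_vars P (\<lambda>_. D) (\<lambda>(t, k). \<xi> t k) ({1..T} \<times> {..<n})"
    and distr: "\<And>t k. t \<in> {1..T} \<Longrightarrow> k < n \<Longrightarrow> distr P D (\<xi> t k) = D"
    and params: "\<eta> > 0" "n \<ge> 1" "T > 0"
    and confidence: "0 < \<delta>h" "\<delta>h < 1" "0 < \<delta>" "\<delta> \<le> \<delta>h / (real m * real T)"
  shows "\<P>(w in P. \<forall>t\<in>{1..T}.
            lb_sgd m M \<sigma> b \<sigma>' \<eta> n \<delta> F G x0 (\<lambda>t k. \<xi> t k w) t \<in> feasible_set m f)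
         \<ge> 1 - \<delta>h"
proof -
  interpret prob_space P
    by (rule prob)
  define x where "x = (\<lambda>t w. lb_sgd m M \<sigma> b \<sigma>' \<eta> n \<delta> F G x0 (\<lambda>t k. \<xi> t k w) t)"
  define Fn where "Fn = (\<lambda>t w i. batch_mean n (F i (x t w)) (\<lambda>k. \<xi> t k w))"
  define Gn where "Gn = (\<lambda>t w i. batch_mean n (G i (x t w)) (\<lambda>k. \<xi> t k w))"
  \<comment> \<open>The summand 0 is the bias of the value oracle, kept so that the event has the
    shape of the general deviation bound.\<close>
  define EF where "EF = (\<lambda>(t, i) w. norm (Fn t w i - f i (x t w))
    \<le> 0 + \<sigma> i / sqrt (real n) * sqrt (ln (1 / \<delta>)))"
  define EG where "EG = (\<lambda>(t, i) w. norm (Gn t w i - grad (f i) (x t w))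
    \<le> b i + \<sigma>' i / sqrt (real n) * sqrt (ln (1 / \<delta> ^ 4)))"
  \<comment> \<open>The points up to index T come from the steps 1 to \<open>T - 1\<close>. Index 0
    is absent since the step size makes any direction g safe, so errors in the objective gradient do
    no harm.\<close>
  define I where "I = {1..<T} \<times> {1..m}"
  have "1 * 1 \<le> real m * real T"
    using m params by (intro mult_mono) auto
  then have "\<delta>h / (real m * real T) \<le> \<delta>h / 1"
    using confidence by (intro divide_left_mono) auto
  then have \<delta>: "0 < \<delta>" "\<delta> < 1" "0 < \<delta> ^ 4" "\<delta> ^ 4 < 1"
    using confidence by (auto intro!: power_Suc_less_one simp: power_less_one_iff)
  have cont: "continuous_on UNIV (f i)" if "i \<in> {0..m}" for i
    using diff[OF that] by (simp add: differentiable_imp_continuous_on differentiable_on_def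
        differentiable_at_withinI)
  have F: "case_prod (F i) \<in> borel_measurable (borel \<Otimes>\<^sub>M D)"
    and G: "case_prod (G i) \<in> borel_measurable (borel \<Otimes>\<^sub>M D)" if "i \<in> {0..m}" for i
    using value_orc[OF that] gradient_orc[OF that]
    by (auto simp: value_oracle_def gradient_oracle_def)
  have f_meas: "f i \<in> borel_measurable borel" and grad_meas: "grad (f i) \<in> borel_measurable borel"
    if "i \<in> {0..m}" for i
    using cont[OF that] borel_measurable_grad[OF diff[OF that]]
    by (auto intro: borel_measurable_continuous_onI)
  have \<xi>: "random_variable D (\<xi> t k)" if "t \<in> {1..T}" "k < n" for t k
  proof -
    have "(t, k) \<in> {1..T} \<times> {..<n}"
      using that by simp
    then show ?thesis
      using indep unfolding indep_vars_def by fastforce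
  qed
  have x [measurable]: "random_variable borel (x t)" if "t \<in> {1..T}" for t
    unfolding x_def using F G by (rule measurable_lb_sgd) (use that \<xi> in auto)
  have Fn: "random_variable borel (\<lambda>w. Fn t w i)" and Gn: "random_variable borel (\<lambda>w. Gn t w i)"
    if "t \<in> {1..T}" "i \<in> {0..m}" for t i
    unfolding Fn_def Gn_def using F[OF that(2)] G[OF that(2)] x[OF that(1)]
    by (auto intro!: measurable_batch_mean \<xi> that)
  have EF: "Measurable.pred P (EF j)" "\<P>(w in P. EF j w) \<ge> 1 - \<delta>"
    and EG: "Measurable.pred P (EG j)" "\<P>(w in P. EG j w) \<ge> 1 - \<delta> ^ 4" if j_in: "j \<in> I" for j
  proof -
    obtain t i where j: "j = (t, i)" and t: "t \<in> {1..T}" and i: "i \<in> {0..m}"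
      using j_in by (auto simp: I_def)
    note [measurable] = f_meas[OF i] grad_meas[OF i] x[OF t] Fn[OF t i] Gn[OF t i]
    show "Measurable.pred P (EF j)" "Measurable.pred P (EG j)"
      unfolding j EF_def EG_def by simp_all
    have x_eq: "x t w = lb_sgd m M \<sigma> b \<sigma>' \<eta> n \<delta> F G x0 (\<lambda>t k. \<xi> t k w) t" for w
      by (simp add: x_def)
    \<comment> \<open>One deviation bound serves the real values at level \<delta> and the gradients
      at level \<open>\<delta> ^ 4\<close>.\<close>
    note batch = prob_batch_mean_lb_sgd[OF prob noise params(2) indep distr _ _ t _ _ _ _ _ x_eq]
    show "\<P>(w in P. EF j w) \<ge> 1 - \<delta>"
      unfolding EF_def j Fn_def case_prod_conv
      by (rule batch) (use F G f_meas \<delta> i value_orc[OF i] in \<open>auto simp: value_oracle_def\<close>)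
    show "\<P>(w in P. EG j w) \<ge> 1 - \<delta> ^ 4"
      unfolding EG_def j Gn_def case_prod_conv
      by (rule batch) (use F G grad_meas \<delta> i gradient_orc[OF i] in \<open>auto simp: gradient_oracle_def\<close>)
  qed
  have feasible: "x t w \<in> feasible_set m f"
    if EFG: "\<forall>j\<in>I. EF j w \<and> EG j w" and t: "t \<in> {1..T}" for t w
    using t
  proof (induction t)
    case (Suc t)
    show ?case
    proof (cases "t = 0")
      case True
      then show ?thesis
        using x0 by (simp add: x_def)
    next
      case False
      have "lb_sgd_step m M \<sigma> b \<sigma>' \<eta> n \<delta> (Fn t w) (Gn t w) (x t w) \<in> feasible_set m f"
      proof (rule lb_sgd_step_feasible[OF m params(1) \<delta>(1,2)])
        show "x t w \<in> feasible_set m f"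
          using Suc False by simp
        fix i assume i: "i \<in> {1..m}"
        then have "(t, i) \<in> I"
          using Suc.prems False by (simp add: I_def)
        then have "EF (t, i) w" "EG (t, i) w"
          using EFG by auto
        then show "norm (Fn t w i - f i (x t w)) \<le> \<sigma> i / sqrt (real n) * sqrt (ln (1 / \<delta>))"
          and "norm (Gn t w i - grad (f i) (x t w))
            \<le> b i + \<sigma>' i / sqrt (real n) * sqrt (ln (1 / \<delta> ^ 4))"
          by (simp_all add: EF_def EG_def)
      qed (use cont smooth pos nonneg in auto)
      then show ?thesis
        using False by (simp add: x_def Fn_def Gn_def Let_def)
    qed
  qed simp
  \<comment> \<open>Closedness makes the event of feasible query points measurable, as monotonicity
    of the probability requires.\<close>
  have "closed (feasible_set m f)"
    using cont by (intro closed_feasible_set) auto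
  then have X [measurable]: "feasible_set m f \<in> sets borel"
    by (rule borel_closed)
  have "1 - \<delta>h \<le> 1 - (\<Sum>j\<in>I. \<delta> + \<delta> ^ 4)"
    using failure_budget[OF m _ confidence(3,4,2)] params(3)
    by (simp add: I_def of_nat_diff mult_ac)
  also have "\<dots> \<le> \<P>(w in P. \<forall>j\<in>I. EF j w \<and> EG j w)"
  proof (rule prob_all_ge_diff_sum)
    fix j assume j: "j \<in> I"
    note [measurable] = EF(1)[OF j] EG(1)[OF j]
    show "Measurable.pred P (\<lambda>w. EF j w \<and> EG j w)"
      by measurable
    \<comment> \<open>The two events share their noise, so a union bound joins them: the same lemma
      with index type bool, values at True and gradients at False.\<close>
    have "\<P>(w in P. \<forall>c\<in>UNIV. (if c then EF j w else EG j w))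
        \<ge> 1 - (\<Sum>c\<in>UNIV. if c then \<delta> else \<delta> ^ 4)"
      using EF[OF j] EG[OF j] by (intro prob_all_ge_diff_sum) (auto split: if_split)
    then show "\<P>(w in P. EF j w \<and> EG j w) \<ge> 1 - (\<delta> + \<delta> ^ 4)"
      by (simp add: UNIV_bool ex_bool_eq conj_commute add.commute)
  qed (simp add: I_def)
  also have "\<dots> \<le> \<P>(w in P. \<forall>t\<in>{1..T}. x t w \<in> feasible_set m f)"
  proof (rule finite_measure_mono)
    show "{w \<in> space P. \<forall>t\<in>{1..T}. x t w \<in> feasible_set m f} \<in> events"
      by measurable
  qed (use feasible in auto)
  finally show ?thesis
    unfolding x_def .
qed

end
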